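(* Let $A$ be a commutative associative superalgebra with parity $p$. The Poisson superalgebra structures on $A$ (with the given commutative associative product) are in bijective correspondence with the set $$\{X\in W_1^{\mathrm{as}}(\Pi A)_{\bar1}\ :\ [X,X]=0\},$$ where the Poisson bracket corresponding to $X$ is $[a,b]=(-1)^{p(a)}X(a,b)$, $a,b\in A$.
   Context: All spaces are over a field $\mathbb F$ of characteristic $0$. For a superspace $U$ with parity $p$, $\Pi U$ is the same space with parity $\bar p=p+\bar1$. Universal Lie superalgebra: for a superspace $V$ with parity $\bar p$, $W(V)=\bigoplus_{k\ge-1}W_k(V)$, $W_k(V)=\mathrm{Hom}(S^{k+1}(V),V)$ (supersymmetric $(k+1)$-linear maps), with induced parity $\bar p$. For $X\in W_h(V)$, $Y\in W_{k-h}(V)$ put $$(X\Box Y)(v_0,\dots,v_k)=\sum_{\substack{i_0<\dots<i_{k-h}\\ i_{k-h+1}<\dots<i_k}}\epsilon_v(i_0,\dots,i_k)X(Y(v_{i_0},\dots,v_{i_{k-h}}),v_{i_{k-h+1}},\dots,v_{i_k}),$$ the sum being over permutations of $(0,\dots,k)$ and $\epsilon_v(i_0,\dots,i_k)=(-1)^M$, with $M$ the number of interchanges of indices of odd $v_i$'s. $[X,Y]=X\Box Y-(-1)^{\bar p(X)\bar p(Y)}Y\Box X$ is a Lie superalgebra bracket; for $Y\in W_{-1}(V)=V$, $[X,Y](v_1,\dots,v_k)=X(Y,v_1,\dots,v_k)$. $\mathrm{Der}(A)$ is the Lie superalgebra of linear maps $X:A\to A$ with $X(ab)=X(a)b+(-1)^{p(a)p(b)}X(b)a$,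 regarded inside $W_0(\Pi A)=\mathrm{End}(\Pi A)$. $W^{\mathrm{as}}(\Pi A)$ is its full prolongation: $W^{\mathrm{as}}_{-1}=\Pi A$, $W_0^{\mathrm{as}}=\mathrm{Der}(A)$, $W_k^{\mathrm{as}}=\{X\in W_k(\Pi A):[X,\Pi A]\subset W^{\mathrm{as}}_{k-1}\}$ for $k\ge1$. The subscript $\bar1$ denotes odd elements (with respect to $\bar p$). A Poisson superalgebra is a commutative associative superalgebra with a Lie superalgebra bracket satisfying $[a,bc]=[a,b]c+(-1)^{p(a)p(b)}b[a,c]$. *)

theory Defs
  imports Complex_Main "HOL-Library.Z2"
begin

instance bit :: finite
proof
  have "(UNIV :: bit set) = {0, 1}" by auto
  then show "finite (UNIV :: bit set)" by (metis finite.emptyI finite.insertI)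
qed

text \<open>Parities are elements of the field \<open>bit\<close> of integers modulo 2; \<open>ksign i v\<close> is \<open>(-1)^i v\<close>.\<close>

definition ksign :: "bit \<Rightarrow> 'v::ab_group_add \<Rightarrow> 'v"
  where "ksign i v = (if i = 0 then v else - v)"

section \<open>Superspaces and superalgebras\<close>

text \<open>The underlying space is the whole type \<open>'v\<close>, and \<open>E i\<close> is its subspace of elements of
  parity \<open>i\<close>. A sign depending on the parity of \<open>v\<close> is only ever stated for \<open>v \<in> E i\<close>.\<close>

locale superspace = vector_space scale
  for scale :: "'f::field_char_0 \<Rightarrow> 'v::ab_group_add \<Rightarrow> 'v" +
  fixes E :: "bit \<Rightarrow> 'v set"
  assumes subspace_E: "subspace (E i)"
    and E_disjoint: "E 0 \<inter> E 1 = {0}"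
    and E_span: "\<exists>u\<in>E 0. \<exists>w\<in>E 1. v = u + w"

text \<open>Component of parity \<open>i\<close> of a vector.\<close>

definition proj :: "(bit \<Rightarrow> 'v set) \<Rightarrow> bit \<Rightarrow> 'v \<Rightarrow> 'v::ab_group_add"
  where "proj E i v = (THE u. u \<in> E i \<and> v - u \<in> E (i + 1))"

definition parity_shift :: "(bit \<Rightarrow> 'v set) \<Rightarrow> bit \<Rightarrow> 'v set"
  where "parity_shift E i = E (i + 1)"

locale superalgebra = superspace scale E
  for scale :: "'f::field_char_0 \<Rightarrow> 'v::ab_group_add \<Rightarrow> 'v" and E :: "bit \<Rightarrow> 'v set" +
  fixes mult :: "'v \<Rightarrow> 'v \<Rightarrow> 'v"
  assumes linear_left: "Vector_Spaces.linear scale scale (\<lambda>a. mult a b)"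
    and linear_right: "Vector_Spaces.linear scale scale (\<lambda>b. mult a b)"
    and mult_parity: "\<lbrakk>a \<in> E i; b \<in> E j\<rbrakk> \<Longrightarrow> mult a b \<in> E (i + j)"

locale comm_assoc_superalgebra = superalgebra scale E mult
  for scale :: "'f::field_char_0 \<Rightarrow> 'v::ab_group_add \<Rightarrow> 'v" and E :: "bit \<Rightarrow> 'v set"
    and mult :: "'v \<Rightarrow> 'v \<Rightarrow> 'v" +
  assumes assoc: "mult (mult a b) c = mult a (mult b c)"
    and supercomm: "\<lbrakk>a \<in> E i; b \<in> E j\<rbrakk> \<Longrightarrow> mult a b = ksign (i * j) (mult b a)"

locale lie_superalgebra = superalgebra scale E br
  for scale :: "'f::field_char_0 \<Rightarrow> 'v::ab_group_add \<Rightarrow> 'v" and E :: "bit \<Rightarrow> 'v set"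
    and br :: "'v \<Rightarrow> 'v \<Rightarrow> 'v" +
  assumes skew: "\<lbrakk>a \<in> E i; b \<in> E j\<rbrakk> \<Longrightarrow> br a b = - ksign (i * j) (br b a)"
    and jacobi: "\<lbrakk>a \<in> E i; b \<in> E j\<rbrakk> \<Longrightarrow>
      br a (br b c) = br (br a b) c + ksign (i * j) (br b (br a c))"

locale poisson_superalgebra =
  comm_assoc_superalgebra scale E mult + lie_superalgebra scale E br
  for scale :: "'f::field_char_0 \<Rightarrow> 'v::ab_group_add \<Rightarrow> 'v" and E :: "bit \<Rightarrow> 'v set"
    and mult :: "'v \<Rightarrow> 'v \<Rightarrow> 'v" and br :: "'v \<Rightarrow> 'v \<Rightarrow> 'v" +
  assumes leibniz: "\<lbrakk>a \<in> E i; b \<in> E j\<rbrakk> \<Longrightarrow>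
      br a (mult b c) = mult (br a b) c + ksign (i * j) (mult b (br a c))"

section \<open>The universal Lie superalgebra\<close>

text \<open>A \<open>(k+1)\<close>-linear map is represented as a function on lists of arguments that vanishes on
  all lists whose length is not \<open>k + 1\<close>; thus \<open>X\<close> in degree \<open>-1\<close> is given by the vector \<open>X []\<close>,
  and elements of the direct sum of all degrees are again functions on lists. Throughout this
  section \<open>E\<close> is the grading of \<open>V\<close> itself, i.e. the one giving the parity written \<open>p\<close>-bar.\<close>

definition W :: "('f::field_char_0 \<Rightarrow> 'v::ab_group_add \<Rightarrow> 'v) \<Rightarrow> (bit \<Rightarrow> 'v set) \<Rightarrow> int
    \<Rightarrow> ('v list \<Rightarrow> 'v) set"
  where "W scale E k = {X.
      (\<forall>vs. int (length vs) \<noteq> k + 1 \<longrightarrow> X vs = 0) \<and>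
      (\<forall>us ws. Vector_Spaces.linear scale scale (\<lambda>v. X (us @ v # ws))) \<and>
      (\<forall>i j. \<forall>u\<in>E i. \<forall>v\<in>E j. \<forall>us ws.
         X (us @ u # v # ws) = ksign (i * j) (X (us @ v # u # ws)))}"

definition W_parity :: "(bit \<Rightarrow> 'v set) \<Rightarrow> bit \<Rightarrow> ('v list \<Rightarrow> 'v) set"
  where "W_parity E i = {X. \<forall>js vs. list_all2 (\<lambda>j v. v \<in> E j) js vs \<longrightarrow> X vs \<in> E (i + sum_list js)}"

text \<open>The list \<open>is @ is'\<close> of indices is a permutation of \<open>[0..<n]\<close> which is increasing on each of
  its two blocks.\<close>

definition shuffles_upto :: "nat \<Rightarrow> (nat list \<times> nat list) set"
  where "shuffles_upto n = {(is, is'). sorted_wrt (<) is \<and> sorted_wrt (<) is' \<and>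
      distinct (is @ is') \<and> set (is @ is') = {..<n}}"

text \<open>Number of interchanges of odd entries in the sequence \<open>is\<close> of indices, where \<open>js ! l\<close> is the
  parity of the \<open>l\<close>-th vector.\<close>

definition odd_interchanges :: "bit list \<Rightarrow> nat list \<Rightarrow> nat"
  where "odd_interchanges js is = card {(a, b). a < b \<and> b < length is \<and> is ! a > is ! b \<and>
      js ! (is ! a) = 1 \<and> js ! (is ! b) = 1}"

text \<open>The box product. The formula for homogeneous arguments is extended multilinearly by summing
  over the parities \<open>js\<close> of the components of the arguments. No restriction on the size of the
  first block is needed: if \<open>Y\<close> has degree \<open>m\<close>, a summand vanishes unless \<open>length is = m + 1\<close>.\<close>

definition box :: "(bit \<Rightarrow> 'v set) \<Rightarrow> ('v list \<Rightarrow> 'v) \<Rightarrow> ('v list \<Rightarrow> 'v) \<Rightarrow> 'v list \<Rightarrow> 'v::ab_group_add"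
  where "box E X Y vs =
      (\<Sum>js | length js = length vs. \<Sum>(is, is') \<in> shuffles_upto (length vs).
         let ws = map2 (proj E) js vs
         in ksign (of_nat (odd_interchanges js (is @ is')))
              (X (Y (map ((!) ws) is) # map ((!) ws) is')))"

text \<open>Component of parity \<open>i\<close> of a multilinear map.\<close>

definition W_proj :: "(bit \<Rightarrow> 'v set) \<Rightarrow> bit \<Rightarrow> ('v list \<Rightarrow> 'v) \<Rightarrow> 'v list \<Rightarrow> 'v::ab_group_add"
  where "W_proj E i X vs =
      (\<Sum>js | length js = length vs. proj E (i + sum_list js) (X (map2 (proj E) js vs)))"

text \<open>The formula for the bracket of homogeneous elements is extended bilinearly.\<close>

definition W_bracket :: "(bit \<Rightarrow> 'v set) \<Rightarrow> ('v list \<Rightarrow> 'v) \<Rightarrow> ('v list \<Rightarrow> 'v) \<Rightarrow> 'v list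
    \<Rightarrow> 'v::ab_group_add"
  where "W_bracket E X Y vs = (\<Sum>i\<in>UNIV. \<Sum>j\<in>UNIV.
      box E (W_proj E i X) (W_proj E j Y) vs
        - ksign (i * j) (box E (W_proj E j Y) (W_proj E i X) vs))"

section \<open>The full prolongation of the derivations\<close>

text \<open>Here \<open>E\<close> is the original grading of \<open>A\<close>, with parity \<open>p\<close>.\<close>

definition Der :: "('f::field_char_0 \<Rightarrow> 'v::ab_group_add \<Rightarrow> 'v) \<Rightarrow> (bit \<Rightarrow> 'v set)
    \<Rightarrow> ('v \<Rightarrow> 'v \<Rightarrow> 'v) \<Rightarrow> ('v list \<Rightarrow> 'v) set"
  where "Der scale E mult = {X \<in> W scale (parity_shift E) 0.
      \<forall>i j. \<forall>a\<in>E i. \<forall>b\<in>E j.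
        X [mult a b] = mult (X [a]) b + ksign (i * j) (mult (X [b]) a)}"

text \<open>Full prolongation, indexed by the number of arguments (the degree plus one).\<close>

fun prolongation :: "('f::field_char_0 \<Rightarrow> 'v::ab_group_add \<Rightarrow> 'v) \<Rightarrow> (bit \<Rightarrow> 'v set)
    \<Rightarrow> ('v list \<Rightarrow> 'v) set \<Rightarrow> nat \<Rightarrow> ('v list \<Rightarrow> 'v) set"
  where
    "prolongation scale E g 0 = W scale E (-1)"
  | "prolongation scale E g (Suc 0) = g"
  | "prolongation scale E g (Suc (Suc n)) = {X \<in> W scale E (int n + 1).
       \<forall>Y \<in> W scale E (-1). W_bracket E X Y \<in> prolongation scale E g (Suc n)}"

definition W_as :: "('f::field_char_0 \<Rightarrow> 'v::ab_group_add \<Rightarrow> 'v) \<Rightarrow> (bit \<Rightarrow> 'v set)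
    \<Rightarrow> ('v \<Rightarrow> 'v \<Rightarrow> 'v) \<Rightarrow> int \<Rightarrow> ('v list \<Rightarrow> 'v) set"
  where "W_as scale E mult k =
      prolongation scale (parity_shift E) (Der scale E mult) (nat (k + 1))"

text \<open>Bilinear extension of \<open>(-1)^p(a) X(a,b)\<close> to all \<open>a\<close>.\<close>

definition bracket_of :: "(bit \<Rightarrow> 'v set) \<Rightarrow> ('v list \<Rightarrow> 'v) \<Rightarrow> 'v \<Rightarrow> 'v \<Rightarrow> 'v::ab_group_add"
  where "bracket_of E X a b = (\<Sum>i\<in>UNIV. ksign i (X [proj E i a, b]))"

end

theory Submission
  imports Defs
begin

text \<open>For \<open>y\<close> in degree \<open>-1\<close> the bracket \<open>[X, y]\<close> is \<open>X(y, _)\<close>, so membership of \<open>X\<close> in the prolongation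
  says that every \<open>X(y, _)\<close> is a derivation, which is the Leibniz rule. Supersymmetry of \<open>X\<close> for the
  shifted parity becomes skew-symmetry of \<open>(-1)^p(a) X(a, b)\<close>. As \<open>X\<close> is odd, \<open>[X, X]\<close> is twice the
  box product of \<open>X\<close> with itself, and in characteristic 0 its vanishing amounts, after the sign
  change, to the Jacobi identity. The sign twist is an involution on bilinear maps, whence
  bijectivity.\<close>

section \<open>Signs\<close>

lemma UNIV_bit: "(UNIV :: bit set) = {0, 1}"
proof -
  have "i \<in> {0, 1}" for i :: bit
    by (cases i) simp_all
  then show ?thesis by blast
qed

lemma ksign_0 [simp]: "ksign 0 v = v"
  by (simp add: ksign_def)

lemma ksign_1 [simp]: "ksign 1 v = - v"
  by (simp add: ksign_def)

lemma ksign_zero [simp]: "ksign i 0 = 0"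
  by (simp add: ksign_def)

lemma ksign_eq_0_iff: "ksign i v = 0 \<longleftrightarrow> v = 0"
  by (simp add: ksign_def)

section \<open>Superspaces\<close>

context superspace
begin

lemma linear_ksign:
  assumes "Vector_Spaces.linear scale scale f"
  shows "Vector_Spaces.linear scale scale (\<lambda>v. ksign i (f v))"
proof -
  interpret f: Vector_Spaces.linear scale scale f by fact
  show ?thesis
    by unfold_locales (simp_all add: ksign_def f.add f.scale)
qed

lemma linear_map_ksign:
  assumes "Vector_Spaces.linear scale scale f"
  shows "f (ksign i v) = ksign i (f v)"
proof -
  interpret f: Vector_Spaces.linear scale scale f by fact
  show ?thesis by (simp add: ksign_def f.neg)
qed

lemma linear_zero: "Vector_Spaces.linear scale scale (\<lambda>v. 0)"
  by unfold_locales simp_all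

lemma linear_add:
  assumes "Vector_Spaces.linear scale scale f" "Vector_Spaces.linear scale scale g"
  shows "Vector_Spaces.linear scale scale (\<lambda>v. f v + g v)"
proof -
  interpret f: Vector_Spaces.linear scale scale f by fact
  interpret g: Vector_Spaces.linear scale scale g by fact
  show ?thesis
    by unfold_locales (simp_all add: f.add f.scale g.add g.scale scale_right_distrib)
qed

lemma linear_comp:
  assumes "Vector_Spaces.linear scale scale f" "Vector_Spaces.linear scale scale g"
  shows "Vector_Spaces.linear scale scale (\<lambda>v. f (g v))"
proof -
  interpret f: Vector_Spaces.linear scale scale f by fact
  interpret g: Vector_Spaces.linear scale scale g by fact
  show ?thesis
    by unfold_locales (simp_all add: f.add f.scale g.add g.scale)
qed

section \<open>Homogeneous components\<close>

lemma zero_mem_E [simp]: "0 \<in> E i"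
  using subspace_E subspace_0 by blast

lemma ksign_mem_E: "v \<in> E i \<Longrightarrow> ksign j v \<in> E i"
  using subspace_E subspace_neg by (auto simp: ksign_def)

lemma eq_zero_if_both: "v \<in> E i \<Longrightarrow> v \<in> E (i + 1) \<Longrightarrow> v = 0"
  using E_disjoint by (cases i) auto

lemma ex_proj: "\<exists>u. u \<in> E i \<and> v - u \<in> E (i + 1)"
proof -
  obtain u w where "u \<in> E 0" "w \<in> E 1" "v = u + w"
    using E_span by blast
  then show ?thesis
    by (cases i) (auto intro: exI[of _ u] exI[of _ w])
qed

text \<open>Two candidates differ by a vector of \<open>E i\<close>, and their remainders differ by
  the same vector up to sign, now in \<open>E (i + 1)\<close>. The two subspaces meet only in 0, so
  the definite description in \<open>proj\<close> is well defined.\<close>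

lemma proj_eqI:
  assumes "u \<in> E i" "v - u \<in> E (i + 1)"
  shows "proj E i v = u"
  unfolding proj_def
proof (rule the_equality)
  fix w assume w: "w \<in> E i \<and> v - w \<in> E (i + 1)"
  have "w - u \<in> E i"
    using w assms subspace_E subspace_diff by blast
  moreover have "(v - u) - (v - w) \<in> E (i + 1)"
    using w assms subspace_E subspace_diff by blast
  ultimately have "w - u = 0"
    by (intro eq_zero_if_both[of _ i]) auto
  then show "w = u" by simp
qed (use assms in auto)

lemma proj_mem: "proj E i v \<in> E i" and diff_proj_mem: "v - proj E i v \<in> E (i + 1)"
proof -
  obtain u where "u \<in> E i" "v - u \<in> E (i + 1)"
    using ex_proj by blast
  with proj_eqI[OF this] show "proj E i v \<in> E i" "v - proj E i v \<in> E (i + 1)"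
    by auto
qed

lemma proj_same: "v \<in> E i \<Longrightarrow> proj E i v = v"
  by (rule proj_eqI) auto

lemma proj_other: "v \<in> E j \<Longrightarrow> i \<noteq> j \<Longrightarrow> proj E i v = 0"
  by (rule proj_eqI) (cases i; cases j; auto)+

lemma proj_zero [simp]: "proj E i 0 = 0"
  by (rule proj_same) simp

lemma linear_proj: "Vector_Spaces.linear scale scale (proj E i)"
proof unfold_locales
  fix u v
  have "(u - proj E i u) + (v - proj E i v) \<in> E (i + 1)"
    using subspace_E subspace_add diff_proj_mem by blast
  then show "proj E i (u + v) = proj E i u + proj E i v"
    by (intro proj_eqI) (simp_all add: subspace_add[OF subspace_E] proj_mem algebra_simps)
next
  fix r v
  have "scale r (v - proj E i v) \<in> E (i + 1)"
    using subspace_E subspace_scale diff_proj_mem by blast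
  then show "proj E i (scale r v) = scale r (proj E i v)"
    by (intro proj_eqI) (simp_all add: subspace_scale[OF subspace_E] proj_mem scale_right_diff_distrib)
qed

lemma sum_proj: "proj E 0 v + proj E 1 v = v"
proof -
  have "proj E 1 v = v - proj E 0 v"
    by (rule proj_eqI) (use diff_proj_mem[of v 0] proj_mem[of 0 v] in auto)
  then show ?thesis by simp
qed

text \<open>Every vector is the sum of its two components. This extends an identity from homogeneous
  vectors to an argument whose parity enters no sign.\<close>

lemma linear_eqI:
  assumes f: "Vector_Spaces.linear scale scale f" and g: "Vector_Spaces.linear scale scale g"
    and eq: "\<And>i v. v \<in> E i \<Longrightarrow> f v = g v"
  shows "f v = g v"
proof -
  interpret f: Vector_Spaces.linear scale scale f by fact
  interpret g: Vector_Spaces.linear scale scale g by fact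
  have "f (proj E 0 v + proj E 1 v) = g (proj E 0 v + proj E 1 v)"
    unfolding f.add g.add by (simp only: eq[OF proj_mem])
  then show ?thesis unfolding sum_proj .
qed

lemma superspace_parity_shift: "superspace scale (parity_shift E)"
proof unfold_locales
  show "subspace (parity_shift E i)" for i
    by (simp add: parity_shift_def subspace_E)
  show "parity_shift E 0 \<inter> parity_shift E 1 = {0}"
    using E_disjoint by (auto simp: parity_shift_def)
  show "\<exists>u\<in>parity_shift E 0. \<exists>w\<in>parity_shift E 1. v = u + w" for v
    using E_span[of v] by (auto simp: parity_shift_def) (metis add.commute)
qed

end

section \<open>Multilinear maps on lists\<close>

lemma lists_length_Suc: "{js. length js = Suc n} = (\<lambda>(j, js). j # js) ` (UNIV \<times> {js. length js = n})"
  by (auto simp: length_Suc_conv image_iff)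

lemma finite_lists_of_length: "finite {js :: 'b::finite list. length js = n}"
  by (induction n) (simp_all add: lists_length_Suc)

lemma sum_lists_length_Suc:
  "(\<Sum>js | length js = Suc n. f js) = (\<Sum>j\<in>UNIV. \<Sum>js | length js = n. f (j # js))"
  by (simp add: lists_length_Suc sum.reindex inj_on_def sum.cartesian_product split_def)

lemma length_eq_2_iff: "length vs = 2 \<longleftrightarrow> (\<exists>a b. vs = [a, b])"
  by (auto simp: numeral_2_eq_2 length_Suc_conv)

context superspace
begin

definition multilinear_on_lists :: "('v list \<Rightarrow> 'v) \<Rightarrow> bool"
  where "multilinear_on_lists X \<longleftrightarrow>
    (\<forall>us ws. Vector_Spaces.linear scale scale (\<lambda>v. X (us @ v # ws)))"

lemma W_multilinear: "X \<in> W scale E k \<Longrightarrow> multilinear_on_lists X"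
  by (simp add: W_def multilinear_on_lists_def)

lemma multilinear_zero:
  assumes "multilinear_on_lists X" "0 \<in> set vs"
  shows "X vs = 0"
proof -
  obtain us ws where vs: "vs = us @ 0 # ws"
    using assms(2) by (meson split_list)
  interpret f: Vector_Spaces.linear scale scale "\<lambda>v. X (us @ v # ws)"
    using assms(1) by (simp add: multilinear_on_lists_def)
  show ?thesis unfolding vs by (rule f.zero)
qed

text \<open>The prefix \<open>us\<close> serves the induction: the component of the head moves into
  it, and additivity in that slot merges the two components.\<close>

lemma multilinear_sum_proj_append:
  assumes "multilinear_on_lists X"
  shows "(\<Sum>js | length js = length vs. X (us @ map2 (proj E) js vs)) = X (us @ vs)"
proof (induction vs arbitrary: us)
  case (Cons v vs)
  interpret f: Vector_Spaces.linear scale scale "\<lambda>v. X (us @ v # vs)"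
    using assms by (simp add: multilinear_on_lists_def)
  have "(\<Sum>js | length js = length (v # vs). X (us @ map2 (proj E) js (v # vs)))
      = (\<Sum>j\<in>UNIV. X (us @ proj E j v # vs))"
    using Cons.IH[of "us @ [proj E j v]" for j] by (simp add: sum_lists_length_Suc)
  also have "\<dots> = X (us @ (proj E 0 v + proj E 1 v) # vs)"
    by (simp add: UNIV_bit f.add)
  finally show ?case by (simp add: sum_proj)
qed auto

lemmas multilinear_sum_proj = multilinear_sum_proj_append[where us = "[]", simplified]

lemma list_all2_proj: "length js = length vs \<Longrightarrow> list_all2 (\<lambda>j v. v \<in> E j) js (map2 (proj E) js vs)"
  by (simp add: list_all2_conv_all_nth proj_mem)

lemma map2_proj_same: "list_all2 (\<lambda>j v. v \<in> E j) ks vs \<Longrightarrow> map2 (proj E) ks vs = vs"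
  by (induction rule: list_all2_induct) (simp_all add: proj_same)

lemma map2_proj_other:
  "list_all2 (\<lambda>j v. v \<in> E j) ks vs \<Longrightarrow> length js = length vs \<Longrightarrow> js \<noteq> ks \<Longrightarrow>
    0 \<in> set (map2 (proj E) js vs)"
proof (induction arbitrary: js rule: list_all2_induct)
  case (Cons k ks v vs)
  then obtain j js' where js: "js = j # js'" "length js' = length vs"
    by (auto simp: length_Suc_conv)
  show ?case
  proof (cases "j = k")
    case True
    then show ?thesis using Cons js by auto
  next
    case False
    then show ?thesis using Cons.hyps js by (simp add: proj_other)
  qed
qed simp

text \<open>Every parity list other than \<open>ks\<close> makes some component 0, so one term
  survives. This recovers the formula for homogeneous arguments, with its sign, from the multilinear
  extension used in \<open>box\<close>.\<close>

lemma sum_proj_homogeneous: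
  assumes hom: "list_all2 (\<lambda>j v. v \<in> E j) ks vs"
    and zero: "\<And>js ws. length js = length ws \<Longrightarrow> 0 \<in> set ws \<Longrightarrow> F js ws = 0"
  shows "(\<Sum>js | length js = length vs. F js (map2 (proj E) js vs)) = F ks vs"
proof -
  have len: "length ks = length vs"
    using hom by (rule list_all2_lengthD)
  have "(\<Sum>js | length js = length vs. F js (map2 (proj E) js vs))
      = (\<Sum>js\<in>{ks}. F js (map2 (proj E) js vs))"
    using len map2_proj_other[OF hom]
    by (intro sum.mono_neutral_right finite_lists_of_length) (auto intro!: zero)
  then show ?thesis using map2_proj_same[OF hom] by simp
qed

text \<open>On homogeneous arguments a homogeneous map has homogeneous values, so each projection is
  the identity or 0. This collapses the sums over parities in \<open>W_bracket\<close>.\<close>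

lemma W_proj_homogeneous:
  assumes "multilinear_on_lists X" "X \<in> W_parity E i"
  shows "W_proj E i X = X" and "j \<noteq> i \<Longrightarrow> W_proj E j X = (\<lambda>_. 0)"
proof -
  have mem: "X (map2 (proj E) js vs) \<in> E (i + sum_list js)" if "length js = length vs" for js vs
    using assms(2) list_all2_proj[OF that] by (simp add: W_parity_def)
  show "W_proj E i X = X"
  proof (rule ext)
    fix vs
    have "W_proj E i X vs = (\<Sum>js | length js = length vs. X (map2 (proj E) js vs))"
      unfolding W_proj_def by (intro sum.cong refl proj_same[OF mem]) simp
    then show "W_proj E i X vs = X vs"
      by (simp add: multilinear_sum_proj[OF assms(1)])
  qed
  show "W_proj E j X = (\<lambda>_. 0)" if "j \<noteq> i"
  proof (rule ext)
    fix vs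
    show "W_proj E j X vs = 0"
      unfolding W_proj_def using that by (intro sum.neutral ballI proj_other[OF mem]) (simp_all only: add_right_cancel mem_Collect_eq not_False_eq_True)
  qed
qed

end

section \<open>The box product in low degrees\<close>

lemma shuffles_upto_lengthD:
  assumes "(is, is') \<in> shuffles_upto n"
  shows "length is + length is' = n"
proof -
  have "distinct (is @ is')" "set (is @ is') = {..<n}"
    using assms by (auto simp: shuffles_upto_def)
  then show ?thesis
    by (metis card_lessThan distinct_card length_append)
qed

lemma finite_shuffles_upto: "finite (shuffles_upto n)"
proof (rule finite_subset)
  let ?L = "{xs. set xs \<subseteq> {..<n} \<and> length xs \<le> n}"
  show "shuffles_upto n \<subseteq> ?L \<times> ?L"
  proof (rule subsetI)
    fix s assume s: "s \<in> shuffles_upto n"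
    obtain "is" is' where s': "s = (is, is')" by fastforce
    from s have "length is + length is' = n" "set is \<union> set is' = {..<n}"
      unfolding s' by (simp_all only: shuffles_upto_lengthD) (simp add: shuffles_upto_def)
    then show "s \<in> ?L \<times> ?L"
      unfolding s' by auto
  qed
  show "finite (?L \<times> ?L)"
    by (intro finite_SigmaI finite_lists_length_le) simp_all
qed

text \<open>A vector in degree -1 takes no arguments, so this is the one shuffle that contributes
  when the inner factor of \<open>box\<close> has degree -1.\<close>

lemma Nil_shuffles_upto: "([], is') \<in> shuffles_upto n \<longleftrightarrow> is' = [0..<n]"
proof
  assume "([], is') \<in> shuffles_upto n"
  then have "sorted_wrt (<) is'" "set is' = set [0..<n]"
    by (simp_all add: shuffles_upto_def lessThan_atLeast0)
  then show "is' = [0..<n]"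
    using strict_sorted_equal[of is' "[0..<n]"] by simp
qed (simp add: shuffles_upto_def lessThan_atLeast0)

text \<open>The first block determines the second as the remaining index. These shuffles will
  produce the three terms of the Jacobi identity.\<close>

lemma shuffles_upto_3_length_2:
  "{s \<in> shuffles_upto 3. length (fst s) = 2} = {([0,1],[2]), ([0,2],[1]), ([1,2],[0])}"
proof -
  have three: "{..<3} = {0, 1, 2 :: nat}" by auto
  have "s \<in> {([0,1],[2]), ([0,2],[1]), ([1,2],[0])}"
    if s: "s \<in> shuffles_upto 3" "length (fst s) = 2" for s
  proof -
    obtain "is" is' where s': "s = (is, is')" by fastforce
    with s have "length is = 2" "length is' = 1"
      using shuffles_upto_lengthD[of "is" is' 3] by simp_all
    then obtain a b c where abc: "is = [a, b]" "is' = [c]"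
      by (auto simp: length_eq_2_iff length_Suc_conv)
    have lt: "a < b" and dist: "c \<noteq> a" "c \<noteq> b" and set: "{a, b, c} = {0, 1, 2}"
      using s unfolding s' abc shuffles_upto_def three by auto
    have "a \<in> {0, 1, 2}" "b \<in> {0, 1, 2}" "c \<in> {0, 1, 2}"
      unfolding set[symmetric] by simp_all
    with lt dist show ?thesis
      unfolding s' abc by auto
  qed
  moreover have "{([0,1],[2]), ([0,2],[1]), ([1,2],[0])} \<subseteq> shuffles_upto 3"
    by (auto simp: shuffles_upto_def three)
  ultimately show ?thesis by auto
qed

section \<open>Signs of the shuffles\<close>

lemma odd_interchanges_sorted: "sorted_wrt (<) is \<Longrightarrow> odd_interchanges js is = 0"
proof -
  assume "sorted_wrt (<) is"
  then have eq: "{(a, b). a < b \<and> b < length is \<and> is ! a > is ! b \<and>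
      js ! (is ! a) = 1 \<and> js ! (is ! b) = 1} = {}"
    by (auto dest: sorted_wrt_nth_less)
  show ?thesis unfolding odd_interchanges_def eq by simp
qed

text \<open>The only inversion is that of the indices 2 and 1. The count is read in
  \<open>bit\<close>, where it becomes the product of the two parities.\<close>

lemma odd_interchanges_021: "of_nat (odd_interchanges [i, j, k] [0, 2, 1]) = j * k"
proof -
  have eq: "{(a, b). a < b \<and> b < length [0,2,1::nat] \<and> [0,2,1::nat] ! a > [0,2,1::nat] ! b \<and>
      [i, j, k] ! ([0,2,1] ! a) = 1 \<and> [i, j, k] ! ([0,2,1] ! b) = 1}
    = (if j = 1 \<and> k = 1 then {(1, 2)} else {})"
    by (auto simp: less_Suc_eq numeral_3_eq_3 numeral_2_eq_2)
  show ?thesis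
    unfolding odd_interchanges_def eq by (cases j; cases k) simp_all
qed

text \<open>Index 0 stands behind 1 and 2, which gives two possible interchanges, contributing
  \<open>i * j\<close> and \<open>i * k\<close> modulo 2.\<close>

lemma odd_interchanges_120: "of_nat (odd_interchanges [i, j, k] [1, 2, 0]) = i * (j + k)"
proof -
  have eq: "{(a, b). a < b \<and> b < length [1,2,0::nat] \<and> [1,2,0::nat] ! a > [1,2,0::nat] ! b \<and>
      [i, j, k] ! ([1,2,0] ! a) = 1 \<and> [i, j, k] ! ([1,2,0] ! b) = 1}
    = (if i = 1 \<and> j = 1 then {(0, 2)} else {}) \<union> (if i = 1 \<and> k = 1 then {(1, 2)} else {})"
    by (auto simp: less_Suc_eq numeral_3_eq_3 numeral_2_eq_2)
  show ?thesis
    unfolding odd_interchanges_def eq by (cases i; cases j; cases k) simp_all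
qed

context superspace
begin

section \<open>Box products and brackets with vectors\<close>

lemma box_vector:
  assumes X: "multilinear_on_lists X" and Y: "\<And>vs. vs \<noteq> [] \<Longrightarrow> Y vs = 0"
  shows "box E X Y vs = X (Y [] # vs)"
proof -
  have X0: "X (0 # ws) = 0" for ws
    by (rule multilinear_zero[OF X]) simp
  have "(\<Sum>(is, is') \<in> shuffles_upto (length vs).
         let ws = map2 (proj E) js vs
         in ksign (of_nat (odd_interchanges js (is @ is')))
              (X (Y (map ((!) ws) is) # map ((!) ws) is')))
      = X ([Y []] @ map2 (proj E) js vs)" (is "sum ?F _ = _") if len: "length js = length vs" for js
  proof -
    \<comment> \<open>A nonempty first block passes arguments to \<open>Y\<close>, whose value is
      then 0, and \<open>X\<close> vanishes with 0 in its first slot.\<close>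
    have "sum ?F (shuffles_upto (length vs)) = sum ?F {([], [0..<length vs])}"
    proof (intro sum.mono_neutral_right finite_shuffles_upto)
      have "is \<noteq> []" if "(is, is') \<in> shuffles_upto (length vs) - {([], [0..<length vs])}" for "is" is'
        using that by (auto simp: Nil_shuffles_upto)
      then show "\<forall>s\<in>shuffles_upto (length vs) - {([], [0..<length vs])}. ?F s = 0"
        by (force simp: Let_def Y X0)
    qed (simp add: Nil_shuffles_upto)
    moreover have "map ((!) (map2 (proj E) js vs)) [0..<length vs] = map2 (proj E) js vs"
      using len map_nth[of "map2 (proj E) js vs"] by simp
    ultimately show ?thesis
      by (simp add: Let_def odd_interchanges_sorted)
  qed
  then have "box E X Y vs = (\<Sum>js | length js = length vs. X ([Y []] @ map2 (proj E) js vs))"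
    unfolding box_def by (intro sum.cong) auto
  also have "\<dots> = X (Y [] # vs)"
    using multilinear_sum_proj_append[OF X, where us = "[Y []]"] by simp
  finally show ?thesis .
qed

lemma W_minus1_eq_0: "Y \<in> W scale E (-1) \<Longrightarrow> vs \<noteq> [] \<Longrightarrow> Y vs = 0"
  by (simp add: W_def)

text \<open>The outer factor always receives at least one argument, namely the value of the inner
  factor.\<close>

lemma box_from_vector:
  assumes "\<And>vs. vs \<noteq> [] \<Longrightarrow> Y vs = 0"
  shows "box E Y X vs = 0"
  unfolding box_def Let_def using assms by (auto intro!: sum.neutral)

text \<open>As \<open>X\<close> is odd, only one parity of the first factor survives, and the box
  product with the vector outside is 0. The vector itself may have mixed parity; its components
  recombine by linearity of \<open>X\<close> in the first slot.\<close>

lemma W_bracket_vector: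
  assumes X: "X \<in> W scale E k" "X \<in> W_parity E 1" and Y: "Y \<in> W scale E (-1)"
  shows "W_bracket E X Y vs = X (Y [] # vs)"
proof -
  note mX = W_multilinear[OF X(1)]
  have PY: "W_proj E j Y vs = (if vs = [] then proj E j (Y []) else 0)" for j vs
  proof (cases "vs = []")
    case False
    then have "Y (map2 (proj E) js vs) = 0" if "length js = length vs" for js
      using that by (intro W_minus1_eq_0[OF Y]) auto
    then show ?thesis
      using False by (simp add: W_proj_def)
  qed (simp add: W_proj_def)
  have b1: "box E X (W_proj E j Y) vs = X (proj E j (Y []) # vs)" for j
    by (subst box_vector[OF mX]) (simp_all add: PY)
  have b2: "box E (W_proj E j Y) Z vs = 0" for j Z
    by (rule box_from_vector) (simp add: PY)
  have b3: "box E (\<lambda>_. 0) Z vs = 0" for Z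
    by (simp add: box_def Let_def)
  interpret f: Vector_Spaces.linear scale scale "\<lambda>v. X ([] @ v # vs)"
    using mX unfolding multilinear_on_lists_def by blast
  have "W_bracket E X Y vs = X ([] @ (proj E 0 (Y []) + proj E 1 (Y [])) # vs)"
    unfolding f.add
    by (simp add: W_bracket_def UNIV_bit W_proj_homogeneous[OF mX X(2)] b1 b2 b3)
  then show ?thesis by (simp add: sum_proj)
qed

section \<open>Self-bracket of an odd element\<close>

lemma W_bracket_self_odd:
  assumes X: "X \<in> W scale E k" "X \<in> W_parity E 1"
  shows "W_bracket E X X vs = box E X X vs + box E X X vs"
proof -
  note mX = W_multilinear[OF X(1)]
  have X0: "X (0 # ws) = 0" for ws
    by (rule multilinear_zero[OF mX]) simp
  have "box E (\<lambda>_. 0) Z vs = 0" "box E X (\<lambda>_. 0) vs = 0" for Z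
    by (simp_all add: box_def Let_def X0)
  \<comment> \<open>For two odd factors the sign in front of the second box product is -(-1) = 1, so
    the two products add up.\<close>
  then show ?thesis
    by (simp add: W_bracket_def UNIV_bit W_proj_homogeneous[OF mX X(2)])
qed

text \<open>The three shuffles give the three terms: the sign \<open>j * k\<close> comes from
  exchanging \<open>b\<close> and \<open>c\<close>, the sign \<open>i * (j + k)\<close> from moving
  \<open>a\<close> past both. Homogeneous arguments suffice because \<open>box\<close> is a sum over
  homogeneous components.\<close>

lemma box_self_eq_0_iff:
  assumes X: "X \<in> W scale E 1"
  shows "box E X X = (\<lambda>_. 0) \<longleftrightarrow>
    (\<forall>i j k. \<forall>a\<in>E i. \<forall>b\<in>E j. \<forall>c\<in>E k.
      X [X [a, b], c] + ksign (j * k) (X [X [a, c], b])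
        + ksign (i * (j + k)) (X [X [b, c], a]) = 0)"
    (is "_ \<longleftrightarrow> ?jac")
proof -
  note mX = W_multilinear[OF X]
  have X_len: "X ws = 0" if "length ws \<noteq> 2" for ws
    using X that by (auto simp: W_def)
  have X0: "X (0 # ws) = 0" for ws
    by (rule multilinear_zero[OF mX]) simp
  \<comment> \<open>The inner sum of \<open>box\<close> for one fixed parity list, taken at
    arbitrary arguments so that it can be evaluated before components are inserted.\<close>
  define H where "H js ws = (\<Sum>(is, is') \<in> shuffles_upto (length ws).
      ksign (of_nat (odd_interchanges js (is @ is')))
        (X (X (map ((!) ws) is) # map ((!) ws) is')))" for js ws
  have box: "box E X X vs = (\<Sum>js | length js = length vs. H js (map2 (proj E) js vs))" for vs
    unfolding box_def H_def Let_def by (intro sum.cong refl) simp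
  \<comment> \<open>The index of a zero argument lies in one of the blocks: in the first it kills
    the inner value, in the second the outer one.\<close>
  have H_zero: "H js ws = 0" if "0 \<in> set ws" for js ws
    unfolding H_def
  proof (rule sum.neutral, clarify)
    fix "is" is' assume s: "(is, is') \<in> shuffles_upto (length ws)"
    then have "set is \<union> set is' = {..<length ws}"
      by (auto simp: shuffles_upto_def)
    with that have "0 \<in> (!) ws ` set is \<or> 0 \<in> (!) ws ` set is'"
      unfolding in_set_conv_nth image_iff by (metis UnE lessThan_iff)
    then have "0 \<in> set (map ((!) ws) is) \<or> 0 \<in> set (map ((!) ws) is')"
      by simp
    then have "X (X (map ((!) ws) is) # map ((!) ws) is') = 0"
      by (metis X0 multilinear_zero[OF mX] list.set_intros(2))
    then show "ksign (of_nat (odd_interchanges js (is @ is')))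
        (X (X (map ((!) ws) is) # map ((!) ws) is')) = 0" by simp
  qed
  \<comment> \<open>The inner \<open>X\<close> needs two arguments and the outer one needs one more
    besides the inner value, three in total.\<close>
  have H_len: "H js ws = 0" if "length ws \<noteq> 3" for js ws
    unfolding H_def
  proof (rule sum.neutral, clarify)
    fix "is" is' assume "(is, is') \<in> shuffles_upto (length ws)"
    then have "length is \<noteq> 2 \<or> length is' \<noteq> 1"
      using that shuffles_upto_lengthD by fastforce
    then have "X (X (map ((!) ws) is) # map ((!) ws) is') = 0"
      by (auto simp: X_len X0)
    then show "ksign (of_nat (odd_interchanges js (is @ is')))
        (X (X (map ((!) ws) is) # map ((!) ws) is')) = 0" by simp
  qed
  have H3: "H [i, j, k] [a, b, c] = X [X [a, b], c] + ksign (j * k) (X [X [a, c], b])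
        + ksign (i * (j + k)) (X [X [b, c], a])" for i j k a b c
  proof -
    have "H [i, j, k] [a, b, c] = (\<Sum>(is, is') \<in> {s \<in> shuffles_upto 3. length (fst s) = 2}.
      ksign (of_nat (odd_interchanges [i, j, k] (is @ is')))
        (X (X (map ((!) [a, b, c]) is) # map ((!) [a, b, c]) is')))"
      (is "_ = sum ?F ?S")
    proof -
      have "sum ?F (shuffles_upto 3) = sum ?F ?S"
      proof (intro sum.mono_neutral_right finite_shuffles_upto ballI)
        fix s assume s: "s \<in> shuffles_upto 3 - ?S"
        obtain "is" is' where "s = (is, is')" by fastforce
        moreover from this s have "length is \<noteq> 2" by auto
        ultimately show "?F s = 0" by (simp add: X_len X0)
      qed auto
      moreover have "length [a, b, c] = 3" by simp
      ultimately show ?thesis by (simp only: H_def)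
    qed
    then show ?thesis
      unfolding shuffles_upto_3_length_2
      by (simp add: odd_interchanges_sorted add.assoc
          odd_interchanges_021[unfolded One_nat_def] odd_interchanges_120[unfolded One_nat_def]
)
  qed
  show ?thesis
  proof
    assume box0: "box E X X = (\<lambda>_. 0)"
    show ?jac
    proof (intro allI ballI)
      fix i j k a b c assume "a \<in> E i" "b \<in> E j" "c \<in> E k"
      then have "list_all2 (\<lambda>j v. v \<in> E j) [i, j, k] [a, b, c]" by simp
      from sum_proj_homogeneous[OF this, of H] box[of "[a, b, c]"] H_zero
      have "H [i, j, k] [a, b, c] = box E X X [a, b, c]" by simp
      then show "X [X [a, b], c] + ksign (j * k) (X [X [a, c], b])
        + ksign (i * (j + k)) (X [X [b, c], a]) = 0"
        by (simp add: H3 box0)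
    qed
  next
    assume jac: ?jac
    \<comment> \<open>Every summand of \<open>box\<close> is \<open>H\<close> at homogeneous
      components, where the assumed identity applies.\<close>
    have "H js (map2 (proj E) js vs) = 0" if len: "length js = length vs" for js vs
    proof (cases "length vs = 3")
      case True
      then obtain a b c where "vs = [a, b, c]"
        by (auto simp: numeral_3_eq_3 length_Suc_conv)
      moreover from True len obtain i j k where "js = [i, j, k]"
        by (auto simp: numeral_3_eq_3 length_Suc_conv)
      ultimately show ?thesis
        using jac by (simp add: H3 proj_mem)
    qed (use len in \<open>simp add: H_len\<close>)
    then show "box E X X = (\<lambda>_. 0)"
      by (intro ext) (simp add: box)
  qed
qed

text \<open>The self-bracket is twice the box product, and 2 is nonzero in a field of characteristic
  0.\<close>

lemma W_bracket_self_eq_0_iff: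
  assumes X: "X \<in> W scale E k" "X \<in> W_parity E 1"
  shows "W_bracket E X X = (\<lambda>_. 0) \<longleftrightarrow> box E X X = (\<lambda>_. 0)"
proof -
  have "x + x = 0 \<longleftrightarrow> x = 0" for x :: 'v
  proof -
    have "scale 2 x = x + x"
      using scale_left_distrib[of 1 1 x] by simp
    then show ?thesis
      by (metis scale_eq_0_iff zero_neq_numeral)
  qed
  then show ?thesis
    by (simp add: fun_eq_iff W_bracket_self_odd[OF X])
qed

end

section \<open>Bilinear maps and the sign twist\<close>

text \<open>\<open>twist E f a b\<close> is the bilinear extension of \<open>(-1)^p(a) f(a, b)\<close>.\<close>

definition twist :: "(bit \<Rightarrow> 'v set) \<Rightarrow> ('v \<Rightarrow> 'v \<Rightarrow> 'v) \<Rightarrow> 'v \<Rightarrow> 'v \<Rightarrow> 'v::ab_group_add"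
  where "twist E f a b = (\<Sum>i\<in>UNIV. ksign i (f (proj E i a) b))"

text \<open>The candidate inverse of \<open>bracket_of\<close>: the twist is an involution, so it
  serves in both directions. The value 0 off length 2 is the convention of \<open>W\<close> in
  degree 1.\<close>

definition cochain_of :: "(bit \<Rightarrow> 'v set) \<Rightarrow> ('v \<Rightarrow> 'v \<Rightarrow> 'v) \<Rightarrow> 'v list \<Rightarrow> 'v::ab_group_add"
  where "cochain_of E br vs = (if length vs = 2 then twist E br (vs ! 0) (vs ! 1) else 0)"

lemma bracket_of_eq_twist: "bracket_of E X = twist E (\<lambda>a b. X [a, b])"
  by (intro ext) (simp add: bracket_of_def twist_def)

context superspace
begin

definition bilin :: "('v \<Rightarrow> 'v \<Rightarrow> 'v) \<Rightarrow> bool"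
  where "bilin f \<longleftrightarrow> (\<forall>b. Vector_Spaces.linear scale scale (\<lambda>a. f a b)) \<and>
    (\<forall>a. Vector_Spaces.linear scale scale (f a))"

lemma bilinD:
  assumes "bilin f"
  shows "Vector_Spaces.linear scale scale (\<lambda>a. f a b)" "Vector_Spaces.linear scale scale (f a)"
  using assms by (auto simp: bilin_def)

lemma bilin_ksign:
  assumes "bilin f"
  shows "f (ksign i a) b = ksign i (f a b)" "f a (ksign i b) = ksign i (f a b)"
  using linear_map_ksign[OF bilinD(1)[OF assms]] linear_map_ksign[OF bilinD(2)[OF assms]] by blast+

lemma bilin_zero_left: "bilin f \<Longrightarrow> f 0 b = 0"
  using Vector_Spaces.linear.axioms(3)[OF bilinD(1)] by (rule module_hom.zero)

lemma twist_homogeneous: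
  assumes "bilin f" "a \<in> E i"
  shows "twist E f a b = ksign i (f a b)"
  using assms by (cases i)
    (simp_all add: twist_def UNIV_bit proj_same proj_other[of a 0 1] proj_other[of a 1 0] bilin_zero_left)

lemma bilin_twist:
  assumes "bilin f"
  shows "bilin (twist E f)"
  unfolding bilin_def
proof safe
  show "Vector_Spaces.linear scale scale (\<lambda>a. twist E f a b)" for b
    unfolding twist_def UNIV_bit
    by (simp del: ksign_0 ksign_1)
      (intro linear_add linear_ksign linear_comp[OF bilinD(1)[OF assms]] linear_proj)
  show "Vector_Spaces.linear scale scale (twist E f a)" for a
    unfolding twist_def [abs_def] UNIV_bit
    by (simp del: ksign_0 ksign_1) (intro linear_add linear_ksign bilinD(2)[OF assms])
qed

lemma bilin_eqI:
  assumes f: "bilin f" and g: "bilin g"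
    and eq: "\<And>i j a b. a \<in> E i \<Longrightarrow> b \<in> E j \<Longrightarrow> f a b = g a b"
  shows "f = g"
proof (intro ext)
  fix a b
  have "f a' b = g a' b" if "a' \<in> E i" for i a'
    by (rule linear_eqI[OF bilinD(2)[OF f] bilinD(2)[OF g]]) (rule eq[OF that])
  then show "f a b = g a b"
    by (rule linear_eqI[OF bilinD(1)[OF f] bilinD(1)[OF g]])
qed

text \<open>The twist keeps the first argument, so the same sign occurs twice and cancels.\<close>

lemma twist_twist:
  assumes "bilin f"
  shows "twist E (twist E f) = f"
proof (rule bilin_eqI)
  show "twist E (twist E f) a b = f a b" if "a \<in> E i" for i a b
    using that by (cases i) (simp_all add: twist_homogeneous bilin_twist assms)
qed (simp_all add: bilin_twist assms)

lemma mem_parity_shift: "v \<in> E i \<Longrightarrow> v \<in> parity_shift E (i + 1)"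
  by (cases i) (simp_all add: parity_shift_def)

text \<open>For an odd \<open>X\<close> the value has shifted parity
  \<open>1 + (i + 1) + (j + 1)\<close>, hence original parity \<open>i + j\<close>: the odd map is
  even for the unshifted grading. Supersymmetry for the shifted parities gives the sign
  \<open>(i + 1) * (j + 1)\<close>.\<close>

lemma W_1_odd_iff:
  "X \<in> W scale (parity_shift E) 1 \<inter> W_parity (parity_shift E) 1 \<longleftrightarrow>
    (\<forall>vs. length vs \<noteq> 2 \<longrightarrow> X vs = 0) \<and> bilin (\<lambda>a b. X [a, b]) \<and>
    (\<forall>i j. \<forall>a\<in>E i. \<forall>b\<in>E j. X [a, b] \<in> E (i + j) \<and>
      X [a, b] = ksign ((i + 1) * (j + 1)) (X [b, a]))" (is "?L \<longleftrightarrow> ?R")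
proof
  assume L: ?L
  have lin: "Vector_Spaces.linear scale scale (\<lambda>v. X (us @ v # ws))" for us ws
    using L by (simp add: W_def)
  have "bilin (\<lambda>a b. X [a, b])"
    unfolding bilin_def using lin[of "[]" "[b]" for b] lin[of "[a]" "[]" for a] by simp
  moreover have "X [a, b] \<in> E (i + j)" "X [a, b] = ksign ((i + 1) * (j + 1)) (X [b, a])"
    if ab: "a \<in> E i" "b \<in> E j" for i j a b
  proof -
    note ab' = mem_parity_shift[OF ab(1)] mem_parity_shift[OF ab(2)]
    have "list_all2 (\<lambda>j v. v \<in> parity_shift E j) [i + 1, j + 1] [a, b]"
      using ab' by simp
    then have "X [a, b] \<in> parity_shift E (1 + sum_list [i + 1, j + 1])"
      using L unfolding W_parity_def by blast
    then show "X [a, b] \<in> E (i + j)"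
      by (cases i; cases j) (simp_all add: parity_shift_def)
    have "X ([] @ a # b # []) = ksign ((i + 1) * (j + 1)) (X ([] @ b # a # []))"
      using L ab' unfolding W_def by blast
    then show "X [a, b] = ksign ((i + 1) * (j + 1)) (X [b, a])" by simp
  qed
  moreover have "\<forall>vs. length vs \<noteq> 2 \<longrightarrow> X vs = 0"
    using L by (simp add: W_def)
  ultimately show ?R by blast
next
  assume R: ?R
  then have X0: "X vs = 0" if "length vs \<noteq> 2" for vs
    using that by blast
  have bilin: "bilin (\<lambda>a b. X [a, b])"
    using R by blast
  \<comment> \<open>In a list of length 2 one argument stands before or behind the variable one; for
    all other lengths the map is 0.\<close>
  have lin: "Vector_Spaces.linear scale scale (\<lambda>v. X (us @ v # ws))" for us ws
  proof (cases "length us + length ws = 1")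
    case True
    then consider a where "us = [a]" "ws = []" | b where "us = []" "ws = [b]"
      by (cases us; cases ws) auto
    then show ?thesis
      using bilinD[OF bilin] by cases simp_all
  next
    case False
    then show ?thesis
      by (simp add: X0 linear_zero)
  qed
  have sym: "X (us @ u # v # ws) = ksign (i * j) (X (us @ v # u # ws))"
    if uv: "u \<in> parity_shift E i" "v \<in> parity_shift E j" for i j u v us ws
  proof (cases "us = [] \<and> ws = []")
    case True
    have "X [u, v] = ksign ((i + 1 + 1) * (j + 1 + 1)) (X [v, u])"
      using R uv unfolding parity_shift_def by blast
    moreover have "(i + 1 + 1) * (j + 1 + 1) = i * j"
      by (cases i; cases j) simp_all
    ultimately show ?thesis
      using True by simp
  next
    case False
    then have "length (us @ u # v # ws) \<noteq> 2" "length (us @ v # u # ws) \<noteq> 2" by auto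
    then show ?thesis by (simp only: X0 ksign_zero not_False_eq_True)
  qed
  have par: "X vs \<in> parity_shift E (1 + sum_list js)"
    if js: "list_all2 (\<lambda>j v. v \<in> parity_shift E j) js vs" for js vs
  proof (cases "length vs = 2")
    case True
    then obtain a b where vs: "vs = [a, b]"
      by (auto simp: length_eq_2_iff)
    with js obtain i j where ij: "js = [i, j]" "a \<in> E (i + 1)" "b \<in> E (j + 1)"
      by (auto simp: list_all2_Cons2 parity_shift_def)
    then have "X [a, b] \<in> E ((i + 1) + (j + 1))"
      using R by blast
    then show ?thesis
      unfolding vs ij by (cases i; cases j) (simp_all add: parity_shift_def)
  next
    case False
    then show ?thesis by (simp add: X0 parity_shift_def)
  qed
  show ?L
    unfolding W_def W_parity_def
    by (intro IntI CollectI conjI allI ballI impI X0 lin sym par) simp_all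
qed

end

section \<open>Poisson brackets\<close>

context comm_assoc_superalgebra
begin

text \<open>The results on \<open>box\<close> and \<open>W_bracket\<close> are stated for the
  grading of the space itself, which here is the shifted one.\<close>

interpretation P: superspace scale "parity_shift E"
  by (rule superspace_parity_shift)

lemma bilin_mult: "bilin mult"
  by (simp add: bilin_def linear_left linear_right)

text \<open>Bracketing with a vector \<open>y\<close> inserts it in the first slot, so the
  prolongation condition says that each \<open>X(y, _)\<close> is a derivation.\<close>

lemma mem_W_as_1_iff:
  assumes X: "X \<in> W scale (parity_shift E) 1 \<inter> W_parity (parity_shift E) 1"
  shows "X \<in> W_as scale E mult 1 \<longleftrightarrow>
    (\<forall>l i j. \<forall>y\<in>E l. \<forall>a\<in>E i. \<forall>b\<in>E j.
      X [y, mult a b] = mult (X [y, a]) b + ksign (i * j) (mult (X [y, b]) a))"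
    (is "_ \<longleftrightarrow> ?R")
proof -
  have X1: "X \<in> W scale (parity_shift E) 1" and X2: "X \<in> W_parity (parity_shift E) 1"
    using X by auto
  have bilin: "bilin (\<lambda>a b. X [a, b])"
    using X W_1_odd_iff by blast
  have br: "W_bracket (parity_shift E) X Y = (\<lambda>vs. X (Y [] # vs))"
    if "Y \<in> W scale (parity_shift E) (-1)" for Y
    by (rule ext) (rule P.W_bracket_vector[OF X1 X2 that])
  have W0: "(\<lambda>vs. X (y # vs)) \<in> W scale (parity_shift E) 0" for y
  proof -
    have "X (y # vs) = 0" if "int (length vs) \<noteq> 1" for vs
      using X1 that by (auto simp: W_def)
    moreover have "Vector_Spaces.linear scale scale (\<lambda>v. X ((y # us) @ v # ws))" for us ws
      using X1 unfolding W_def by blast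
    moreover have "X ((y # us) @ u # v # ws) = ksign (i * j) (X ((y # us) @ v # u # ws))"
      if "u \<in> parity_shift E i" "v \<in> parity_shift E j" for i j u v us ws
      using X1 that unfolding W_def by blast
    ultimately show ?thesis
      by (simp add: W_def)
  qed
  \<comment> \<open>Every vector occurs as \<open>Y []\<close> for some \<open>Y\<close> of degree
    -1, which turns the quantifier over \<open>Y\<close> into one over \<open>y\<close>.\<close>
  have vec: "(\<lambda>vs. if vs = [] then y else 0) \<in> W scale (parity_shift E) (-1)" for y
    by (auto simp: W_def linear_zero)
  \<comment> \<open>Degree 1 has index 2 in \<open>prolongation\<close>, where the next lower stage
    is \<open>Der\<close>.\<close>
  have "X \<in> W_as scale E mult 1 \<longleftrightarrow>
      (\<forall>Y \<in> W scale (parity_shift E) (-1). (\<lambda>vs. X (Y [] # vs)) \<in> Der scale E mult)"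
    using X1 br by (simp add: W_as_def eval_nat_numeral)
  also have "\<dots> \<longleftrightarrow> (\<forall>y. (\<lambda>vs. X (y # vs)) \<in> Der scale E mult)"
    using vec by fastforce
  also have "\<dots> \<longleftrightarrow> (\<forall>y i j. \<forall>a\<in>E i. \<forall>b\<in>E j.
      X [y, mult a b] = mult (X [y, a]) b + ksign (i * j) (mult (X [y, b]) a))"
    using W0 by (simp add: Der_def)
  also have "\<dots> \<longleftrightarrow> ?R"
  proof
    assume R: ?R
    show "\<forall>y i j. \<forall>a\<in>E i. \<forall>b\<in>E j.
      X [y, mult a b] = mult (X [y, a]) b + ksign (i * j) (mult (X [y, b]) a)"
    proof (intro allI ballI)
      fix y i j a b assume ab: "a \<in> E i" "b \<in> E j"
      have l: "Vector_Spaces.linear scale scale (\<lambda>y. mult (X [y, a]) b)" for a b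
        by (rule linear_comp[OF linear_left bilinD(1)[OF bilin]])
      \<comment> \<open>The parity of \<open>y\<close> enters no sign, so linearity reduces to
        homogeneous \<open>y\<close>.\<close>
      show "X [y, mult a b] = mult (X [y, a]) b + ksign (i * j) (mult (X [y, b]) a)"
        by (rule linear_eqI[OF bilinD(1)[OF bilin] linear_add[OF l linear_ksign[OF l]]])
          (use R ab in blast)
    qed
  qed blast
  finally show ?thesis .
qed

text \<open>Grading and skew-symmetry come from \<open>X\<close> being an odd element of degree 1;
  the Leibniz rule matches membership in the prolongation, and the Jacobi identity matches the
  vanishing of the self-bracket.\<close>

lemma poisson_bracket_of_iff:
  assumes X: "X \<in> W scale (parity_shift E) 1 \<inter> W_parity (parity_shift E) 1"
  shows "poisson_superalgebra scale E mult (bracket_of E X) \<longleftrightarrow>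
    X \<in> W_as scale E mult 1 \<and> W_bracket (parity_shift E) X X = (\<lambda>_. 0)"
proof -
  define br where "br = bracket_of E X"
  have bX: "bilin (\<lambda>a b. X [a, b])"
    and X_mem: "\<And>i j a b. a \<in> E i \<Longrightarrow> b \<in> E j \<Longrightarrow> X [a, b] \<in> E (i + j)"
    and X_sym: "\<And>i j a b. a \<in> E i \<Longrightarrow> b \<in> E j \<Longrightarrow> X [a, b] = ksign ((i + 1) * (j + 1)) (X [b, a])"
    using X unfolding W_1_odd_iff by blast+
  have X_ksign: "X [ksign i a, b] = ksign i (X [a, b])" "X [a, ksign i b] = ksign i (X [a, b])" for i a b
    using bilin_ksign[OF bX] by simp_all
  have bb: "bilin br"
    by (simp add: br_def bracket_of_eq_twist bilin_twist bX)
  have br: "br a b = ksign i (X [a, b])" if "a \<in> E i" for i a b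
    using twist_homogeneous[OF bX that] by (simp add: br_def bracket_of_eq_twist)
  have br_mem: "br a b \<in> E (i + j)" if "a \<in> E i" "b \<in> E j" for i j a b
    using that X_mem ksign_mem_E by (simp only: br)
  \<comment> \<open>Modulo 2, \<open>(i + 1) * (j + 1)\<close> is \<open>i * j + i + j + 1\<close>;
    the twists on the two sides absorb \<open>i\<close> and \<open>j\<close>, and the 1 is the minus
    sign.\<close>
  have br_skew: "br a b = - ksign (i * j) (br b a)" if "a \<in> E i" "b \<in> E j" for i j a b
    unfolding br[OF that(1)] br[OF that(2)] X_sym[OF that]
    by (cases i; cases j) simp_all
  have super: "superalgebra scale E br"
    by (intro superalgebra.intro superalgebra_axioms.intro superspace_axioms bilinD[OF bb] br_mem)

  \<comment> \<open>The Jacobi identity\<close>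
  have jac: "(\<forall>i j a b c. a \<in> E i \<longrightarrow> b \<in> E j \<longrightarrow>
        br a (br b c) = br (br a b) c + ksign (i * j) (br b (br a c))) \<longleftrightarrow>
      W_bracket (parity_shift E) X X = (\<lambda>_. 0)" (is "?J \<longleftrightarrow> _")
  proof -
    have iff: "br a (br b c) = br (br a b) c + ksign (i * j) (br b (br a c)) \<longleftrightarrow>
        X [X [a, b], c] + ksign ((j + 1) * (k + 1)) (X [X [a, c], b])
          + ksign ((i + 1) * (j + 1 + (k + 1))) (X [X [b, c], a]) = 0"
      if abc: "a \<in> E i" "b \<in> E j" "c \<in> E k" for i j k a b c
    proof -
      \<comment> \<open>The outer sign has exponent \<open>i + j\<close>, the inner one
        \<open>i\<close>, and only \<open>j\<close> remains.\<close>
      have brbr: "br (br a b) c = ksign j (X [X [a, b], c])"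
        if "a \<in> E i" "b \<in> E j" for i j a b c
      proof -
        have "br (br a b) c = ksign (i + j) (ksign i (X [X [a, b], c]))"
          using br[OF br_mem[OF that]] br[OF that(1)] X_ksign by metis
        then show ?thesis
          by (cases i; cases j) simp_all
      qed
      \<comment> \<open>Skew-symmetry brings the inner bracket of the other two terms to the first
        slot, where \<open>brbr\<close> applies.\<close>
      have "br a (br b c) = - ksign (i * (j + k)) (ksign k (X [X [b, c], a]))"
        unfolding br_skew[OF abc(1) br_mem[OF abc(2,3)]] brbr[OF abc(2,3)] ..
      moreover have "br b (br a c) = - ksign (j * (i + k)) (ksign k (X [X [a, c], b]))"
        unfolding br_skew[OF abc(2) br_mem[OF abc(1,3)]] brbr[OF abc(1,3)] ..
      moreover note brbr[OF abc(1,2), of c]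
      \<comment> \<open>All three terms share the sign with exponent \<open>j + 1\<close>, so the
        defect of the Jacobi identity is, up to sign, the box product expression.\<close>
      ultimately have "br a (br b c) - (br (br a b) c + ksign (i * j) (br b (br a c)))
          = ksign (j + 1) (X [X [a, b], c] + ksign ((j + 1) * (k + 1)) (X [X [a, c], b])
            + ksign ((i + 1) * (j + 1 + (k + 1))) (X [X [b, c], a]))"
        by (cases i; cases j; cases k) (simp_all add: algebra_simps)
      then show ?thesis
        by (metis eq_iff_diff_eq_0 ksign_eq_0_iff)
    qed
    have "W_bracket (parity_shift E) X X = (\<lambda>_. 0) \<longleftrightarrow>
      (\<forall>i j k. \<forall>a\<in>parity_shift E i. \<forall>b\<in>parity_shift E j. \<forall>c\<in>parity_shift E k.
        X [X [a, b], c] + ksign (j * k) (X [X [a, c], b])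
          + ksign (i * (j + k)) (X [X [b, c], a]) = 0)" (is "_ \<longleftrightarrow> ?Q")
      using X P.W_bracket_self_eq_0_iff P.box_self_eq_0_iff by blast
    also have "\<dots> \<longleftrightarrow> (\<forall>i j k. \<forall>a\<in>E i. \<forall>b\<in>E j. \<forall>c\<in>E k.
        br a (br b c) = br (br a b) c + ksign (i * j) (br b (br a c)))" (is "_ \<longleftrightarrow> ?H")
    proof
      assume Q: ?Q
      show ?H
      proof (intro allI ballI)
        fix i j k a b c assume abc: "a \<in> E i" "b \<in> E j" "c \<in> E k"
        then show "br a (br b c) = br (br a b) c + ksign (i * j) (br b (br a c))"
          unfolding iff[OF abc] using Q mem_parity_shift by blast
      qed
    next
      assume H: ?H
      show ?Q
      proof (intro allI ballI)
        fix i j k a b c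
        assume "a \<in> parity_shift E i" "b \<in> parity_shift E j" "c \<in> parity_shift E k"
        then have abc: "a \<in> E (i + 1)" "b \<in> E (j + 1)" "c \<in> E (k + 1)"
          by (simp_all only: parity_shift_def)
        \<comment> \<open>Shifting a parity twice restores it, so the signs of \<open>iff\<close> at
          the parities \<open>i + 1\<close>, \<open>j + 1\<close>, \<open>k + 1\<close> become those
          required.\<close>
        have shift: "l + 1 + 1 = l" for l :: bit
          by (cases l) simp_all
        from H abc iff[OF abc] show "X [X [a, b], c] + ksign (j * k) (X [X [a, c], b])
          + ksign (i * (j + k)) (X [X [b, c], a]) = 0"
          unfolding shift by blast
      qed
    qed
    also have "\<dots> \<longleftrightarrow> ?J"
    proof
      assume H: ?H
      show ?J
      proof (intro allI impI)
        fix i j a b c assume ab: "a \<in> E i" "b \<in> E j"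
        \<comment> \<open>The parity of \<open>c\<close> enters no sign, so linearity in
          \<open>c\<close> extends the homogeneous case.\<close>
        show "br a (br b c) = br (br a b) c + ksign (i * j) (br b (br a c))"
          by (rule linear_eqI[OF linear_comp[OF bilinD(2)[OF bb] bilinD(2)[OF bb]]
                linear_add[OF bilinD(2)[OF bb]
                  linear_ksign[OF linear_comp[OF bilinD(2)[OF bb] bilinD(2)[OF bb]]]]])
            (use H ab in blast)
      qed
    qed blast
    finally show ?thesis ..
  qed

  \<comment> \<open>The Leibniz rule\<close>
  have leib: "(\<forall>i j a b c. a \<in> E i \<longrightarrow> b \<in> E j \<longrightarrow>
        br a (mult b c) = mult (br a b) c + ksign (i * j) (mult b (br a c))) \<longleftrightarrow>
      X \<in> W_as scale E mult 1" (is "?J \<longleftrightarrow> _")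
  proof -
    have iff: "br a (mult b c) = mult (br a b) c + ksign (i * j) (mult b (br a c)) \<longleftrightarrow>
        X [a, mult b c] = mult (X [a, b]) c + ksign (j * k) (mult (X [a, c]) b)"
      if abc: "a \<in> E i" "b \<in> E j" "c \<in> E k" for i j k a b c
    proof -
      \<comment> \<open>Moving \<open>b\<close> past an element of parity \<open>i + k\<close> costs
        \<open>j * (i + k)\<close>. The part \<open>i * j\<close> cancels the sign in the Leibniz
        rule, which leaves the derivation sign \<open>j * k\<close> and the common twist
        \<open>i\<close>.\<close>
      have "mult b (br a c) = ksign i (ksign (j * (i + k)) (mult (X [a, c]) b))"
        unfolding br[OF abc(1)] bilin_ksign[OF bilin_mult]
        using supercomm[OF abc(2) X_mem[OF abc(1,3)]] by (simp only:)
      then have "br a (mult b c) - (mult (br a b) c + ksign (i * j) (mult b (br a c)))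
          = ksign i (X [a, mult b c] - (mult (X [a, b]) c + ksign (j * k) (mult (X [a, c]) b)))"
        unfolding br[OF abc(1)] bilin_ksign[OF bilin_mult]
        by (cases i; cases j; cases k) (simp_all add: algebra_simps)
      then show ?thesis
        by (metis eq_iff_diff_eq_0 ksign_eq_0_iff)
    qed
    have "X \<in> W_as scale E mult 1 \<longleftrightarrow> (\<forall>i j k. \<forall>a\<in>E i. \<forall>b\<in>E j. \<forall>c\<in>E k.
        br a (mult b c) = mult (br a b) c + ksign (i * j) (mult b (br a c)))" (is "_ \<longleftrightarrow> ?H")
      unfolding mem_W_as_1_iff[OF X] using iff by blast
    also have "\<dots> \<longleftrightarrow> ?J"
    proof
      assume H: ?H
      show ?J
      proof (intro allI impI)
        fix i j a b c assume ab: "a \<in> E i" "b \<in> E j"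
        show "br a (mult b c) = mult (br a b) c + ksign (i * j) (mult b (br a c))"
          by (rule linear_eqI[OF linear_comp[OF bilinD(2)[OF bb] linear_right]
                linear_add[OF linear_right
                  linear_ksign[OF linear_comp[OF linear_right bilinD(2)[OF bb]]]]])
            (use H ab in blast)
      qed
    qed blast
    finally show ?thesis ..
  qed

  \<comment> \<open>With grading, bilinearity and skew-symmetry established, the remaining axioms
    are the Leibniz rule and the Jacobi identity.\<close>
  have "poisson_superalgebra scale E mult br \<longleftrightarrow>
    (\<forall>i j a b c. a \<in> E i \<longrightarrow> b \<in> E j \<longrightarrow>
        br a (mult b c) = mult (br a b) c + ksign (i * j) (mult b (br a c))) \<and>
    (\<forall>i j a b c. a \<in> E i \<longrightarrow> b \<in> E j \<longrightarrow>
        br a (br b c) = br (br a b) c + ksign (i * j) (br b (br a c)))"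
    unfolding poisson_superalgebra_def poisson_superalgebra_axioms_def
      lie_superalgebra_def lie_superalgebra_axioms_def
    using super br_skew comm_assoc_superalgebra_axioms by blast
  then show ?thesis
    unfolding jac leib unfolding br_def .
qed

end

section \<open>Bijectivity of the bracket map\<close>

theorem proposition3p7:
  fixes scale :: "'f::field_char_0 \<Rightarrow> 'a::ab_group_add \<Rightarrow> 'a"
    and A :: "bit \<Rightarrow> 'a set"
    and mult :: "'a \<Rightarrow> 'a \<Rightarrow> 'a"
  assumes "comm_assoc_superalgebra scale A mult"
  shows "bij_betw (bracket_of A)
    {X \<in> W_as scale A mult 1 \<inter> W_parity (parity_shift A) 1.
       W_bracket (parity_shift A) X X = (\<lambda>_. 0)}
    {br. poisson_superalgebra scale A mult br}"
    (is "bij_betw _ ?S ?T")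
proof -
  interpret comm_assoc_superalgebra scale A mult by fact
  let ?C = "W scale (parity_shift A) 1 \<inter> W_parity (parity_shift A) 1"
  have S: "X \<in> ?C" if "X \<in> ?S" for X
    using that by (simp add: W_as_def eval_nat_numeral)
  have T: "bilin br" "cochain_of A br \<in> ?C" if "br \<in> ?T" for br
  proof -
    interpret lie: lie_superalgebra scale A br
      using that by (simp add: poisson_superalgebra_def)
    show bb: "bilin br"
      by (simp add: bilin_def lie.linear_left lie.linear_right)
    have co: "cochain_of A br [a, b] = twist A br a b" for a b
      by (simp add: cochain_of_def)
    show "cochain_of A br \<in> ?C"
      unfolding W_1_odd_iff co
    proof (intro conjI allI ballI impI)
      show "cochain_of A br vs = 0" if "length vs \<noteq> 2" for vs
        using that by (simp add: cochain_of_def)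
      show "bilin (twist A br)"
        by (rule bilin_twist[OF bb])
      fix i j a b assume ab: "a \<in> A i" "b \<in> A j"
      note tw = twist_homogeneous[OF bb ab(1)] twist_homogeneous[OF bb ab(2)]
      show "twist A br a b \<in> A (i + j)"
        unfolding tw by (rule ksign_mem_E[OF lie.mult_parity[OF ab]])
      \<comment> \<open>The sign computation for skew-symmetry read backwards: twisting turns it
        into supersymmetry for the shifted parities.\<close>
      show "twist A br a b = ksign ((i + 1) * (j + 1)) (twist A br b a)"
        unfolding tw lie.skew[OF ab] by (cases i; cases j) simp_all
    qed
  qed
  have bc: "bracket_of A (cochain_of A br) = br" if "br \<in> ?T" for br
    using twist_twist[OF T(1)[OF that]] by (simp add: bracket_of_eq_twist cochain_of_def)
  \<comment> \<open>\<open>X\<close> is determined by its values on lists of length 2, where the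
    double twist is the identity.\<close>
  have cb: "cochain_of A (bracket_of A X) = X" if "X \<in> ?S" for X
  proof (rule ext)
    fix vs
    have X: "bilin (\<lambda>a b. X [a, b])" "length vs \<noteq> 2 \<Longrightarrow> X vs = 0"
      using S[OF that] unfolding W_1_odd_iff by blast+
    show "cochain_of A (bracket_of A X) vs = X vs"
      using X(2) twist_twist[OF X(1)]
      by (cases "length vs = 2") (auto simp: cochain_of_def bracket_of_eq_twist length_eq_2_iff)
  qed
  show ?thesis
  proof (rule bij_betw_byWitness[where f' = "cochain_of A"])
    show "bracket_of A ` ?S \<subseteq> ?T"
      using poisson_bracket_of_iff S by blast
    show "cochain_of A ` ?T \<subseteq> ?S"
    proof safe
      fix br assume br: "poisson_superalgebra scale A mult br"
      then have C: "cochain_of A br \<in> ?C" using T(2) by blast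
      \<comment> \<open>The equivalence applies to \<open>cochain_of A br\<close>, whose bracket is
        \<open>br\<close> again by \<open>bc\<close>.\<close>
      from poisson_bracket_of_iff[OF C] bc br
      show "cochain_of A br \<in> W_as scale A mult 1"
        "W_bracket (parity_shift A) (cochain_of A br) (cochain_of A br) = (\<lambda>_. 0)"
        by auto
      show "cochain_of A br \<in> W_parity (parity_shift A) 1"
        using C by blast
    qed
  qed (use bc cb in auto)
qed

end
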